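(* Let $X,Y$ be two finite symmetric generating sets for a group $G$. If $(G,X)$ has a logspace normal form, then so does $(G,Y)$.
   Context: A deterministic logspace transducer is a deterministic machine with a finite state control and three tapes: a read-only input tape storing the input word; a read-write work tape restricted to at most $c\log n$ squares, where $n$ is the length of the input word and $c$ is a fixed constant; and a write-only output tape written from left to right. In each transition it may modify the work tape, change state, move the input read-head, and write at most a fixed constant number of letters to the output tape. For finite alphabets $X,Y$, a function $f:X^*\to Y^*$ is logspace computable if some deterministic logspace transducer outputs $f(w)$ on every input $w\in X^*$ ($X^*$ is the set of finite words over $X$, including the empty word $\lambda$). Let $G$ be a group with finite symmetric (closed under inverses) generating set $X$; for $w\in X^*$ let $\overline{w}\in G$ denote the element it represents. A normal form for $(G,X)$ is a subset $L\subseteq X^*$ such that $w\mapsto\overline{w}$ restricts to a bijection $L\to G$. A logspace normal form function for $(G,X)$ is a logspace computable $f:X^*\to X^*$ such that, for some normal form $L$, $f(w)$ is the unique element of $L$ with $\overline{f(w)}=\overline{w}$, for all $w\in X^*$. $(G,X)$ has a logspace normal form if it has a logspace normal form function. *)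

theory Defs
  imports Complex_Main "HOL-Algebra.Generated_Groups"
begin

text \<open>
  The input word is written on the read-only tape between two end markers: square 0 holds
  \<open>Left_End\<close>, squares 1 to n hold the letters and square n + 1 holds \<open>Right_End\<close>.
\<close>

datatype 'x input_symbol = Left_End | Letter 'x | Right_End

definition input_at :: "'x list \<Rightarrow> nat \<Rightarrow> 'x input_symbol" where
  "input_at w i =
     (if i = 0 then Left_End else if i \<le> length w then Letter (w ! (i - 1)) else Right_End)"

datatype direction = Move_Left | Stay | Move_Right

text \<open>Both tapes with moving heads have a left end; a head told to move left there stays put.\<close>

fun move_head :: "direction \<Rightarrow> nat \<Rightarrow> nat" where
  "move_head Move_Left i = i - 1"
| "move_head Stay i = i"
| "move_head Move_Right i = Suc i"

text \<open>
  \<open>delta M q a b\<close>, for state \<open>q\<close>, scanned input symbol \<open>a\<close> and scanned work symbol \<open>b\<close>, is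
  \<open>None\<close> if the machine halts, and otherwise gives the new state, the work symbol written,
  the moves of the input and work heads, and the word appended to the output tape.
\<close>

record ('q, 'g, 'x, 'y) transducer =
  states :: "'q set"
  work_alphabet :: "'g set"
  start :: 'q
  blank :: 'g
  delta :: "'q \<Rightarrow> 'x input_symbol \<Rightarrow> 'g \<Rightarrow> ('q \<times> 'g \<times> direction \<times> direction \<times> 'y list) option"

definition transducer :: "'x set \<Rightarrow> 'y set \<Rightarrow> ('q, 'g, 'x, 'y) transducer \<Rightarrow> bool" where
  "transducer X Y M \<longleftrightarrow>
     finite (states M) \<and> finite (work_alphabet M) \<and>
     start M \<in> states M \<and> blank M \<in> work_alphabet M \<and>
     (\<exists>k. \<forall>q \<in> states M. \<forall>a \<in> {Left_End, Right_End} \<union> Letter ` X. \<forall>b \<in> work_alphabet M.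
        \<forall>q' b' d e u. delta M q a b = Some (q', b', d, e, u) \<longrightarrow>
          q' \<in> states M \<and> b' \<in> work_alphabet M \<and> u \<in> lists Y \<and> length u \<le> k)"

record ('q, 'g, 'y) config =
  state :: 'q
  input_pos :: nat
  work_tape :: "nat \<Rightarrow> 'g"
  work_pos :: nat
  output_tape :: "'y list"

definition init_config :: "('q, 'g, 'x, 'y) transducer \<Rightarrow> ('q, 'g, 'y) config" where
  "init_config M =
     \<lparr>state = start M, input_pos = 1, work_tape = (\<lambda>_. blank M), work_pos = 0, output_tape = []\<rparr>"

definition step ::
  "('q, 'g, 'x, 'y) transducer \<Rightarrow> 'x list \<Rightarrow> ('q, 'g, 'y) config \<Rightarrow> ('q, 'g, 'y) config option"
where
  "step M w c =
     (case delta M (state c) (input_at w (input_pos c)) (work_tape c (work_pos c)) of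
        None \<Rightarrow> None
      | Some (q, b, d, e, u) \<Rightarrow>
          Some \<lparr>state = q,
                input_pos = min (move_head d (input_pos c)) (length w + 1),
                work_tape = (work_tape c)(work_pos c := b),
                work_pos = move_head e (work_pos c),
                output_tape = output_tape c @ u\<rparr>)"

definition reachable ::
  "('q, 'g, 'x, 'y) transducer \<Rightarrow> 'x list \<Rightarrow> ('q, 'g, 'y) config \<Rightarrow> bool"
where
  "reachable M w c \<longleftrightarrow> (\<lambda>c c'. step M w c = Some c')\<^sup>*\<^sup>* (init_config M) c"

definition outputs :: "('q, 'g, 'x, 'y) transducer \<Rightarrow> 'x list \<Rightarrow> 'y list \<Rightarrow> bool" where
  "outputs M w v \<longleftrightarrow> (\<exists>c. reachable M w c \<and> step M w c = None \<and> output_tape c = v)"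

text \<open>
  Square \<open>i\<close> of the work tape is the \<open>(i + 1)\<close>-st one. The base of the logarithm is absorbed
  into the constant, and \<open>max 2\<close> only serves to give inputs of length 0 and 1, where log n is
  undefined or zero, constantly many squares.
\<close>

definition logspace_bounded :: "'x set \<Rightarrow> ('q, 'g, 'x, 'y) transducer \<Rightarrow> bool" where
  "logspace_bounded X M \<longleftrightarrow>
     (\<exists>c::real. \<forall>w \<in> lists X. \<forall>C. reachable M w C \<longrightarrow>
        real (work_pos C + 1) \<le> c * log 2 (real (max 2 (length w))))"

text \<open>
  States and work symbols can be taken to be natural numbers, since both sets are finite.
\<close>

definition logspace_computable :: "'x set \<Rightarrow> 'y set \<Rightarrow> ('x list \<Rightarrow> 'y list) \<Rightarrow> bool" where
  "logspace_computable X Y f \<longleftrightarrow>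
     f \<in> lists X \<rightarrow> lists Y \<and>
     (\<exists>M :: (nat, nat, 'x, 'y) transducer.
        transducer X Y M \<and> logspace_bounded X M \<and> (\<forall>w \<in> lists X. outputs M w (f w)))"

definition symmetric_generating_set :: "('a, 'b) monoid_scheme \<Rightarrow> 'a set \<Rightarrow> bool" where
  "symmetric_generating_set G X \<longleftrightarrow>
     X \<subseteq> carrier G \<and> (\<forall>x \<in> X. inv\<^bsub>G\<^esub> x \<in> X) \<and> generate G X = carrier G"

definition word_value :: "('a, 'b) monoid_scheme \<Rightarrow> 'a list \<Rightarrow> 'a" where
  "word_value G w = foldr (\<otimes>\<^bsub>G\<^esub>) w \<one>\<^bsub>G\<^esub>"

definition normal_form :: "('a, 'b) monoid_scheme \<Rightarrow> 'a set \<Rightarrow> 'a list set \<Rightarrow> bool" where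
  "normal_form G X L \<longleftrightarrow> L \<subseteq> lists X \<and> bij_betw (word_value G) L (carrier G)"

text \<open>Uniqueness of \<open>f w\<close> in \<open>L\<close> is part of \<open>L\<close> being a normal form.\<close>

definition logspace_normal_form_function ::
  "('a, 'b) monoid_scheme \<Rightarrow> 'a set \<Rightarrow> ('a list \<Rightarrow> 'a list) \<Rightarrow> bool"
where
  "logspace_normal_form_function G X f \<longleftrightarrow>
     logspace_computable X X f \<and>
     (\<exists>L. normal_form G X L \<and>
        (\<forall>w \<in> lists X. f w \<in> L \<and> word_value G (f w) = word_value G w))"

definition has_logspace_normal_form :: "('a, 'b) monoid_scheme \<Rightarrow> 'a set \<Rightarrow> bool" where
  "has_logspace_normal_form G X \<longleftrightarrow> (\<exists>f. logspace_normal_form_function G X f)"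

end

theory Submission
  imports Defs "HOL-Library.Nat_Bijection"
begin

text \<open>
  Write every letter of \<open>Y\<close> as a word over \<open>X\<close> and every letter of \<open>X\<close> as a word over \<open>Y\<close>, each
  representing the same group element, and let \<open>\<tau>\<close> and \<open>\<sigma>\<close> be the resulting substitutions on
  words. If \<open>f\<close> is a normal form function over \<open>X\<close> with normal form \<open>L\<close>, then \<open>\<sigma> \<circ> f \<circ> \<tau>\<close> is one
  over \<open>Y\<close> with normal form \<open>\<sigma> ` L\<close>: neither substitution changes the value of a word, so \<open>\<sigma>\<close> is
  injective on \<open>L\<close> and \<open>\<sigma> ` L\<close> still has one word for each element of \<open>G\<close>.

  What has to be shown is that logspace computability survives substitution on both sides
  (\<open>logspace_computable_substitution\<close>). A machine for \<open>f\<close> can run on \<open>\<tau> w\<close> while only \<open>w\<close> is on the tape: its input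
  head is represented by the head on \<open>w\<close> together with a bounded offset into the current block
  \<open>\<tau> y\<close>, and the offset fits into the finite control. If no block is empty, one step of the
  original machine becomes exactly one step of the new one, with the same work tape. Since \<open>\<tau> w\<close> is
  longer than \<open>w\<close> by at most a constant factor, the space bound changes by a constant factor too.

  Nonempty blocks can be had whenever \<open>X\<close> has a letter \<open>x\<close>, as the identity is represented by \<open>x\<close>
  followed by its inverse. If \<open>X\<close> is empty, the group is trivial and the constant function with
  value the empty word will do.
\<close>

section \<open>Substitutions\<close>

definition subst :: "('a \<Rightarrow> 'b list) \<Rightarrow> 'a list \<Rightarrow> 'b list" where
  "subst \<sigma> w = concat (map \<sigma> w)"

lemma subst_simps [simp]:
  "subst \<sigma> [] = []"
  "subst \<sigma> (x # w) = \<sigma> x @ subst \<sigma> w"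
  "subst \<sigma> (v @ w) = subst \<sigma> v @ subst \<sigma> w"
  by (simp_all add: subst_def)

lemma subst_in_lists:
  assumes "\<And>x. x \<in> X \<Longrightarrow> \<sigma> x \<in> lists Y" and "w \<in> lists X"
  shows "subst \<sigma> w \<in> lists Y"
  using assms(2) by (induction w) (auto simp: assms(1))

lemma length_subst_le:
  assumes "\<And>x. x \<in> X \<Longrightarrow> length (\<sigma> x) \<le> K" and "w \<in> lists X"
  shows "length (subst \<sigma> w) \<le> K * length w"
  using assms(2) by (induction w) (auto intro: add_mono assms(1))

lemma bounded_block_length:
  fixes \<sigma> :: "'a \<Rightarrow> 'b list"
  assumes "finite X"
  obtains K where "K \<ge> 1" and "\<And>x. x \<in> X \<Longrightarrow> length (\<sigma> x) \<le> K"
proof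
  show "1 \<le> Suc (\<Sum>x\<in>X. length (\<sigma> x))"
    by simp
  show "length (\<sigma> x) \<le> Suc (\<Sum>x\<in>X. length (\<sigma> x))" if "x \<in> X" for x
    using member_le_sum[OF that, of "\<lambda>x. length (\<sigma> x)"] assms by simp
qed

section \<open>Running a transducer on a substituted input\<close>

text \<open>
  The end markers count as blocks of length one, which makes all squares of the input tape alike.
\<close>

fun block_length :: "('y \<Rightarrow> 'x list) \<Rightarrow> 'y input_symbol \<Rightarrow> nat" where
  "block_length \<tau> (Letter y) = length (\<tau> y)"
| "block_length \<tau> _ = 1"

text \<open>
  A head entering a block from the right does not know the length of the block yet. It therefore
  uses an offset that is too large, and every offset is cut down to the last letter of the block
  once the block is scanned.
\<close>

definition offset_in_block :: "('y \<Rightarrow> 'x list) \<Rightarrow> 'y input_symbol \<Rightarrow> nat \<Rightarrow> nat" where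
  "offset_in_block \<tau> a r = min r (block_length \<tau> a - 1)"

fun block_symbol :: "('y \<Rightarrow> 'x list) \<Rightarrow> 'y input_symbol \<Rightarrow> nat \<Rightarrow> 'x input_symbol" where
  "block_symbol \<tau> Left_End j = Left_End"
| "block_symbol \<tau> (Letter y) j = Letter (\<tau> y ! j)"
| "block_symbol \<tau> Right_End j = Right_End"

fun block_move :: "nat \<Rightarrow> nat \<Rightarrow> direction \<Rightarrow> nat \<Rightarrow> direction \<times> nat" where
  "block_move K l Move_Left j = (if j = 0 then (Move_Left, K) else (Stay, j - 1))"
| "block_move K l Stay j = (Stay, j)"
| "block_move K l Move_Right j = (if Suc j < l then (Stay, Suc j) else (Move_Right, 0))"

definition block_start :: "('y \<Rightarrow> 'x list) \<Rightarrow> 'y list \<Rightarrow> nat \<Rightarrow> nat" where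
  "block_start \<tau> w i = (\<Sum>k<i. block_length \<tau> (input_at w k))"

lemma block_start_0 [simp]: "block_start \<tau> w 0 = 0"
  by (simp add: block_start_def)

lemma block_start_Suc:
  "block_start \<tau> w (Suc i) = block_start \<tau> w i + block_length \<tau> (input_at w i)"
  by (simp add: block_start_def)

lemma block_start_eq_length:
  "i \<le> length w \<Longrightarrow> block_start \<tau> w (Suc i) = Suc (length (subst \<tau> (take i w)))"
proof (induction i)
  case 0
  then show ?case by (simp add: block_start_Suc input_at_def)
next
  case (Suc i)
  then show ?case
    by (simp add: block_start_Suc[of \<tau> w "Suc i"] input_at_def take_Suc_conv_app_nth)
qed

lemma block_start_mono: "i \<le> k \<Longrightarrow> block_start \<tau> w i \<le> block_start \<tau> w k"
  unfolding block_start_def by (rule sum_mono2) auto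

lemma input_at_subst:
  assumes "i \<le> Suc (length w)" and "j < block_length \<tau> (input_at w i)"
  shows "input_at (subst \<tau> w) (block_start \<tau> w i + j) = block_symbol \<tau> (input_at w i) j"
proof -
  consider "i = 0" | k where "i = Suc k" "k < length w" | "i = Suc (length w)"
    using assms(1) by (cases i) (auto simp: le_less)
  then show ?thesis
  proof cases
    case 1
    then show ?thesis using assms(2) by (simp add: input_at_def)
  next
    case 2
    have split: "subst \<tau> w = subst \<tau> (take k w) @ \<tau> (w ! k) @ subst \<tau> (drop (Suc k) w)"
      using id_take_nth_drop[OF 2(2)] by (metis subst_simps(2,3))
    have "j < length (\<tau> (w ! k))"
      using assms(2) 2 by (simp add: input_at_def)
    then show ?thesis
      using 2 by (simp add: block_start_eq_length input_at_def split nth_append)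
  next
    case 3
    then show ?thesis using assms(2) by (simp add: input_at_def block_start_eq_length)
  qed
qed

definition virtual_pos :: "('y \<Rightarrow> 'x list) \<Rightarrow> 'y list \<Rightarrow> nat \<Rightarrow> nat \<Rightarrow> nat" where
  "virtual_pos \<tau> w i r = block_start \<tau> w i + offset_in_block \<tau> (input_at w i) r"

text \<open>
  A move inside a block changes the offset only. A move across the boundary of a block reaches an
  adjacent letter of the substituted word because the next block is not empty, and the offset
  \<open>K\<close> means the last letter because no block is longer than \<open>K\<close>.
\<close>

lemma virtual_pos_move:
  assumes nonempty: "\<And>i. 0 < block_length \<tau> (input_at w i)"
    and bounded: "\<And>i. block_length \<tau> (input_at w i) \<le> K"
    and i: "i \<le> Suc (length w)"
    and move: "block_move K (block_length \<tau> (input_at w i)) d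
                 (offset_in_block \<tau> (input_at w i) r) = (d', r')"
  shows "virtual_pos \<tau> w (min (move_head d' i) (length w + 1)) r' =
    min (move_head d (virtual_pos \<tau> w i r)) (length (subst \<tau> w) + 1)"
proof -
  let ?l = "\<lambda>i. block_length \<tau> (input_at w i)"
  let ?j = "offset_in_block \<tau> (input_at w i) r"
  have j: "?j < ?l i"
    using nonempty[of i] by (auto simp: offset_in_block_def)
  have last: "block_start \<tau> w (Suc (length w)) = Suc (length (subst \<tau> w))"
    by (simp add: block_start_eq_length)
  have end_length: "?l (Suc (length w)) = 1"
    by (simp add: input_at_def)
  have pos: "block_start \<tau> w i + ?j \<le> Suc (length (subst \<tau> w))"
  proof (cases "i = Suc (length w)")
    case True
    then show ?thesis using j end_length last by simp
  next
    case False
    then have "block_start \<tau> w (Suc i) \<le> Suc (length (subst \<tau> w))"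
      using block_start_mono[of "Suc i" "Suc (length w)" \<tau> w] i last by simp
    then show ?thesis using j by (simp add: block_start_Suc)
  qed
  show ?thesis
  proof (cases d)
    case Move_Left
    show ?thesis
    proof (cases "?j = 0")
      case True
      then have d': "d' = Move_Left" "r' = K"
        using move Move_Left by auto
      show ?thesis
      proof (cases i)
        case 0
        then show ?thesis
          using Move_Left True d'
          by (simp add: virtual_pos_def offset_in_block_def input_at_def)
      next
        case (Suc k)
        have "offset_in_block \<tau> (input_at w k) K = ?l k - 1"
          using bounded[of k] by (simp add: offset_in_block_def)
        moreover have "min k (length w + 1) = k"
          using i Suc by simp
        ultimately show ?thesis
          using Move_Left True d' Suc nonempty[of k] pos
          by (simp add: virtual_pos_def block_start_Suc)
      qed
    next
      case False
      then have d': "d' = Stay" "r' = ?j - 1"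
        using move Move_Left by auto
      have "offset_in_block \<tau> (input_at w i) r' = ?j - 1"
        using d' j by (simp add: offset_in_block_def)
      then show ?thesis
        using Move_Left False d' i pos by (simp add: virtual_pos_def)
    qed
  next
    case Stay
    then have d': "d' = Stay" "r' = ?j"
      using move by auto
    have "offset_in_block \<tau> (input_at w i) r' = ?j"
      using d' by (simp add: offset_in_block_def)
    then show ?thesis
      using Stay d' i pos by (simp add: virtual_pos_def)
  next
    case Move_Right
    show ?thesis
    proof (cases "Suc ?j < ?l i")
      case True
      then have d': "d' = Stay" "r' = Suc ?j"
        using move Move_Right by auto
      have inner: "offset_in_block \<tau> (input_at w i) r' = Suc ?j"
        using d' True by (simp add: offset_in_block_def)
      have "i \<noteq> Suc (length w)"
        using True end_length by auto
      then have "block_start \<tau> w (Suc i) \<le> Suc (length (subst \<tau> w))"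
        using block_start_mono[of "Suc i" "Suc (length w)" \<tau> w] i last by simp
      then show ?thesis
        using Move_Right True d' i inner by (simp add: virtual_pos_def block_start_Suc)
    next
      case False
      then have d': "d' = Move_Right" "r' = 0"
        using move Move_Right by auto
      have step: "block_start \<tau> w i + Suc ?j = block_start \<tau> w (Suc i)"
        using j False by (simp add: block_start_Suc)
      show ?thesis
      proof (cases "i = Suc (length w)")
        case True
        then show ?thesis
          using Move_Right d' last end_length
          by (simp add: virtual_pos_def offset_in_block_def)
      next
        case False
        then have "block_start \<tau> w (Suc i) \<le> Suc (length (subst \<tau> w))"
          using block_start_mono[of "Suc i" "Suc (length w)" \<tau> w] i last by simp
        then show ?thesis
          using Move_Right d' step False i
          by (simp add: virtual_pos_def offset_in_block_def)
      qed
    qed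
  qed
qed

text \<open>
  The pairing function keeps the states natural numbers, as \<open>logspace_computable\<close> asks for. Only
  the input side needs extra memory: the images of the output letters are written at once, since
  each step of \<open>M\<close> writes boundedly many letters.
\<close>

definition subst_transducer ::
  "('y \<Rightarrow> 'x list) \<Rightarrow> ('z \<Rightarrow> 'v list) \<Rightarrow> nat \<Rightarrow> (nat, 'g, 'x, 'z) transducer
     \<Rightarrow> (nat, 'g, 'y, 'v) transducer"
where
  "subst_transducer \<tau> \<sigma> K M =
     \<lparr>states = prod_encode ` (states M \<times> {..K}),
      work_alphabet = work_alphabet M,
      start = prod_encode (start M, 0),
      blank = blank M,
      delta = (\<lambda>s a b.
        case prod_decode s of (q, r) \<Rightarrow>
          let j = offset_in_block \<tau> a r in
          case delta M q (block_symbol \<tau> a j) b of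
            None \<Rightarrow> None
          | Some (q', b', d, e, u) \<Rightarrow>
              (case block_move K (block_length \<tau> a) d j of
                 (d', r') \<Rightarrow> Some (prod_encode (q', r'), b', d', e, subst \<sigma> u)))\<rparr>"

definition simulates ::
  "('y \<Rightarrow> 'x list) \<Rightarrow> ('z \<Rightarrow> 'v list) \<Rightarrow> 'y list \<Rightarrow> (nat, 'g, 'z) config \<Rightarrow> (nat, 'g, 'v) config
     \<Rightarrow> bool"
where
  "simulates \<tau> \<sigma> w c C \<longleftrightarrow>
     (\<exists>r. state C = prod_encode (state c, r) \<and>
        input_pos C \<le> Suc (length w) \<and>
        input_pos c = virtual_pos \<tau> w (input_pos C) r \<and>
        work_tape C = work_tape c \<and>
        work_pos C = work_pos c \<and>
        output_tape C = subst \<sigma> (output_tape c))"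

lemma block_length_input_at:
  assumes "\<And>y. y \<in> Y \<Longrightarrow> \<tau> y \<noteq> []" and "\<And>y. y \<in> Y \<Longrightarrow> length (\<tau> y) \<le> K"
    and "K \<ge> 1" and "w \<in> lists Y"
  shows "0 < block_length \<tau> (input_at w i)" and "block_length \<tau> (input_at w i) \<le> K"
proof -
  have "w ! (i - 1) \<in> Y" if "i \<noteq> 0" "i \<le> length w"
    using assms(4) that by (auto simp: in_lists_conv_set)
  then show "0 < block_length \<tau> (input_at w i)" and "block_length \<tau> (input_at w i) \<le> K"
    using assms(1-3) by (auto simp: input_at_def)
qed

lemma block_move_le:
  assumes "block_move K l d j = (d', r')" and "j \<le> K" and "l \<le> K"
  shows "r' \<le> K"
  using assms by (cases d) (auto split: if_splits)

lemma transducer_subst_transducer: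
  assumes M: "transducer X Z M" and "finite Z"
    and \<tau>: "\<And>y. y \<in> Y \<Longrightarrow> \<tau> y \<in> lists X"
    and nonempty: "\<And>y. y \<in> Y \<Longrightarrow> \<tau> y \<noteq> []"
    and bounded: "\<And>y. y \<in> Y \<Longrightarrow> length (\<tau> y) \<le> K" and K: "K \<ge> 1"
    and \<sigma>: "\<And>z. z \<in> Z \<Longrightarrow> \<sigma> z \<in> lists V"
  shows "transducer Y V (subst_transducer \<tau> \<sigma> K M)" (is "transducer Y V ?N")
proof -
  have fields: "states ?N = prod_encode ` (states M \<times> {..K})"
      "work_alphabet ?N = work_alphabet M" "start ?N = prod_encode (start M, 0)"
      "blank ?N = blank M"
    by (simp_all add: subst_transducer_def)
  obtain k where k: "\<And>q a b q' b' d e u. q \<in> states M \<Longrightarrow>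
      a \<in> {Left_End, Right_End} \<union> Letter ` X \<Longrightarrow> b \<in> work_alphabet M \<Longrightarrow>
      delta M q a b = Some (q', b', d, e, u) \<Longrightarrow>
      q' \<in> states M \<and> b' \<in> work_alphabet M \<and> u \<in> lists Z \<and> length u \<le> k"
    using M unfolding transducer_def by metis
  obtain m where m: "\<And>z. z \<in> Z \<Longrightarrow> length (\<sigma> z) \<le> m"
    using bounded_block_length[OF \<open>finite Z\<close>, of \<sigma>] by metis
  have "t \<in> prod_encode ` (states M \<times> {..K}) \<and> b' \<in> work_alphabet M \<and>
      v \<in> lists V \<and> length v \<le> m * k"
    if s: "s \<in> prod_encode ` (states M \<times> {..K})"
      and a: "a \<in> {Left_End, Right_End} \<union> Letter ` Y" and b: "b \<in> work_alphabet M"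
      and eq: "delta ?N s a b = Some (t, b', d', e, v)"
    for s a b t b' d' e v
  proof -
    obtain q r where q: "s = prod_encode (q, r)" "q \<in> states M" "r \<le> K"
      using s by auto
    let ?j = "offset_in_block \<tau> a r"
    obtain q' d u r' where M_step: "delta M q (block_symbol \<tau> a ?j) b = Some (q', b', d, e, u)"
      and move: "block_move K (block_length \<tau> a) d ?j = (d', r')"
      and res: "t = prod_encode (q', r')" "v = subst \<sigma> u"
      using eq q(1)
      by (auto simp: subst_transducer_def Let_def split: option.splits prod.splits)
    have "block_symbol \<tau> a ?j \<in> {Left_End, Right_End} \<union> Letter ` X"
    proof (cases a)
      case (Letter y)
      then have y: "y \<in> Y" using a by auto
      have "?j < length (\<tau> y)"
        using length_greater_0_conv[of "\<tau> y"] nonempty[OF y] Letter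
        by (simp add: offset_in_block_def min_less_iff_disj)
      then have "\<tau> y ! ?j \<in> X"
        using \<tau>[OF y] by (auto simp: in_lists_conv_set)
      then show ?thesis using Letter by simp
    qed auto
    from k[OF q(2) this b M_step]
    have q': "q' \<in> states M" "b' \<in> work_alphabet M" "u \<in> lists Z" "length u \<le> k"
      by auto
    have "block_length \<tau> a \<le> K"
      using a bounded K by (cases a) auto
    moreover have "?j \<le> K"
      using q(3) by (simp add: offset_in_block_def)
    ultimately have "r' \<le> K"
      using block_move_le[OF move] by simp
    moreover have "v \<in> lists V"
      unfolding res by (rule subst_in_lists[OF \<sigma> q'(3)])
    moreover have "length v \<le> m * k"
      using length_subst_le[OF m q'(3)] q'(4) res(2) by (meson le_trans mult_le_mono2)
    ultimately show ?thesis
      using q' res(1) by auto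
  qed
  then have "\<forall>s \<in> states ?N. \<forall>a \<in> {Left_End, Right_End} \<union> Letter ` Y. \<forall>b \<in> work_alphabet ?N.
      \<forall>t b' d e v. delta ?N s a b = Some (t, b', d, e, v) \<longrightarrow>
        t \<in> states ?N \<and> b' \<in> work_alphabet ?N \<and> v \<in> lists V \<and> length v \<le> m * k"
    unfolding fields by (intro ballI allI impI)
  moreover have "finite (states ?N)" and "finite (work_alphabet ?N)"
    and "start ?N \<in> states ?N" and "blank ?N \<in> work_alphabet ?N"
    using M by (auto simp: transducer_def fields)
  ultimately show ?thesis
    unfolding transducer_def by (intro conjI exI[of _ "m * k"])
qed

text \<open>
  The relator on options compares the halting behaviour as well as the successors. It therefore
  transfers runs in both directions: from \<open>M\<close> to the new machine for the output, and back to \<open>M\<close>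
  for the space bound.
\<close>

lemma simulates_step:
  assumes nonempty: "\<And>i. 0 < block_length \<tau> (input_at w i)"
    and bounded: "\<And>i. block_length \<tau> (input_at w i) \<le> K"
    and sim: "simulates \<tau> \<sigma> w c C"
  shows "rel_option (simulates \<tau> \<sigma> w)
    (step M (subst \<tau> w) c) (step (subst_transducer \<tau> \<sigma> K M) w C)"
proof -
  obtain r where C: "state C = prod_encode (state c, r)" "input_pos C \<le> Suc (length w)"
      "input_pos c = virtual_pos \<tau> w (input_pos C) r" "work_tape C = work_tape c"
      "work_pos C = work_pos c" "output_tape C = subst \<sigma> (output_tape c)"
    using sim unfolding simulates_def by blast
  define a where "a = input_at w (input_pos C)"
  define j where "j = offset_in_block \<tau> a r"
  have "j < block_length \<tau> a"
    using nonempty[of "input_pos C"] by (auto simp: j_def a_def offset_in_block_def)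
  then have sym: "input_at (subst \<tau> w) (input_pos c) = block_symbol \<tau> a j"
    using input_at_subst[OF C(2)] C(3) by (simp add: virtual_pos_def a_def j_def)
  show ?thesis
  proof (cases "delta M (state c) (block_symbol \<tau> a j) (work_tape c (work_pos c))")
    case None
    then show ?thesis
      using C(1,4-6) by (simp add: step_def sym subst_transducer_def a_def[symmetric] j_def[symmetric])
  next
    case (Some out)
    obtain q b d e u where out: "out = (q, b, d, e, u)"
      by (cases out) auto
    obtain d' r' where move: "block_move K (block_length \<tau> a) d j = (d', r')"
      by fastforce
    have "virtual_pos \<tau> w (min (move_head d' (input_pos C)) (length w + 1)) r' =
        min (move_head d (input_pos c)) (length (subst \<tau> w) + 1)"
      unfolding C(3)
      by (rule virtual_pos_move[OF nonempty bounded C(2)]) (use move in \<open>simp add: a_def j_def\<close>)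
    then show ?thesis
      using C(1,2,4-6) Some out move
      by (simp add: step_def sym subst_transducer_def a_def[symmetric] j_def[symmetric]
          simulates_def)
  qed
qed

lemma simulates_init:
  assumes "\<And>i. 0 < block_length \<tau> (input_at w i)"
  shows "simulates \<tau> \<sigma> w (init_config M) (init_config (subst_transducer \<tau> \<sigma> K M))"
  by (simp add: simulates_def init_config_def subst_transducer_def virtual_pos_def
      offset_in_block_def block_start_Suc input_at_def)

context
  fixes \<tau> :: "'y \<Rightarrow> 'x list" and w :: "'y list" and K :: nat
  assumes nonempty: "\<And>i. 0 < block_length \<tau> (input_at w i)"
    and bounded: "\<And>i. block_length \<tau> (input_at w i) \<le> K"
begin

lemma reachable_simulated:
  assumes "reachable (subst_transducer \<tau> \<sigma> K M) w C"
  shows "\<exists>c. reachable M (subst \<tau> w) c \<and> simulates \<tau> \<sigma> w c C"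
  using assms unfolding reachable_def
proof (induction rule: rtranclp_induct)
  case base
  then show ?case using simulates_init[OF nonempty] by blast
next
  case (step C C')
  then obtain c where c: "(\<lambda>c c'. step M (subst \<tau> w) c = Some c')\<^sup>*\<^sup>* (init_config M) c"
    and sim: "simulates \<tau> \<sigma> w c C"
    by blast
  obtain c' where "step M (subst \<tau> w) c = Some c'" "simulates \<tau> \<sigma> w c' C'"
    using simulates_step[OF nonempty bounded sim, of M] step.hyps(2)
    by (auto simp: option_rel_Some2)
  then show ?case
    using c by (meson rtranclp.rtrancl_into_rtrancl)
qed

lemma reachable_simulating:
  assumes "reachable M (subst \<tau> w) c"
  shows "\<exists>C. reachable (subst_transducer \<tau> \<sigma> K M) w C \<and> simulates \<tau> \<sigma> w c C"
  using assms unfolding reachable_def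
proof (induction rule: rtranclp_induct)
  case base
  then show ?case using simulates_init[OF nonempty] by blast
next
  case (step c c')
  then obtain C where C: "(\<lambda>C C'. step (subst_transducer \<tau> \<sigma> K M) w C = Some C')\<^sup>*\<^sup>*
      (init_config (subst_transducer \<tau> \<sigma> K M)) C"
    and sim: "simulates \<tau> \<sigma> w c C"
    by blast
  obtain C' where "step (subst_transducer \<tau> \<sigma> K M) w C = Some C'" "simulates \<tau> \<sigma> w c' C'"
    using simulates_step[OF nonempty bounded sim, of M] step.hyps(2)
    by (auto simp: option_rel_Some1)
  then show ?case
    using C by (meson rtranclp.rtrancl_into_rtrancl)
qed

lemma outputs_subst_transducer:
  assumes "outputs M (subst \<tau> w) v"
  shows "outputs (subst_transducer \<tau> \<sigma> K M) w (subst \<sigma> v)"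
proof -
  obtain c where c: "reachable M (subst \<tau> w) c" "step M (subst \<tau> w) c = None" "output_tape c = v"
    using assms unfolding outputs_def by blast
  obtain C where C: "reachable (subst_transducer \<tau> \<sigma> K M) w C" and sim: "simulates \<tau> \<sigma> w c C"
    using reachable_simulating[OF c(1)] by blast
  have "step (subst_transducer \<tau> \<sigma> K M) w C = None"
    using simulates_step[OF nonempty bounded sim, of M] c(2) by simp
  moreover have "output_tape C = subst \<sigma> v"
    using sim c(3) by (auto simp: simulates_def)
  ultimately show ?thesis
    using C unfolding outputs_def by blast
qed

end

text \<open>
  An input longer by a factor of \<open>K\<close> adds the constant \<open>log 2 K\<close> to the logarithm. As inputs count
  as having length at least two, this constant is at most \<open>log 2 K\<close> times the logarithm.
\<close>

lemma log_length_subst_le: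
  assumes "\<And>y. y \<in> Y \<Longrightarrow> length (\<tau> y) \<le> K" and "K \<ge> 1" and "w \<in> lists Y"
  shows "log 2 (real (max 2 (length (subst \<tau> w)))) \<le>
    (log 2 (real K) + 1) * log 2 (real (max 2 (length w)))"
proof -
  let ?n = "max 2 (length w)"
  have "length (subst \<tau> w) \<le> K * length w"
    using assms by (intro length_subst_le)
  also have "\<dots> \<le> K * ?n"
    by simp
  finally have "max 2 (length (subst \<tau> w)) \<le> K * ?n"
    using assms(2) mult_le_mono[of 1 K 2 ?n] by simp
  then have "real (max 2 (length (subst \<tau> w))) \<le> real K * real ?n"
    by (metis of_nat_le_iff of_nat_mult)
  then have "log 2 (real (max 2 (length (subst \<tau> w)))) \<le> log 2 (real K * real ?n)"
    by simp
  also have "\<dots> = log 2 (real K) + log 2 (real ?n)"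
    using assms(2) by (intro log_mult_pos) auto
  also have "\<dots> \<le> (log 2 (real K) + 1) * log 2 (real ?n)"
  proof -
    have "0 \<le> log 2 (real K)" and "1 \<le> log 2 (real ?n)"
      using assms(2) by (simp_all add: le_log_iff)
    then show ?thesis
      using mult_left_mono[of 1 "log 2 (real ?n)" "log 2 (real K)"] by (simp add: algebra_simps)
  qed
  finally show ?thesis .
qed

lemma logspace_bounded_subst_transducer:
  assumes "logspace_bounded X M"
    and \<tau>: "\<And>y. y \<in> Y \<Longrightarrow> \<tau> y \<in> lists X"
    and nonempty: "\<And>y. y \<in> Y \<Longrightarrow> \<tau> y \<noteq> []"
    and bounded: "\<And>y. y \<in> Y \<Longrightarrow> length (\<tau> y) \<le> K" and K: "K \<ge> 1"
  shows "logspace_bounded Y (subst_transducer \<tau> \<sigma> K M)"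
proof -
  obtain c where c: "\<And>w C. w \<in> lists X \<Longrightarrow> reachable M w C \<Longrightarrow>
      real (work_pos C + 1) \<le> c * log 2 (real (max 2 (length w)))"
    using assms(1) unfolding logspace_bounded_def by blast
  have "real (work_pos C + 1) \<le> (\<bar>c\<bar> * (log 2 (real K) + 1)) * log 2 (real (max 2 (length w)))"
    if w: "w \<in> lists Y" and C: "reachable (subst_transducer \<tau> \<sigma> K M) w C" for w C
  proof -
    obtain C\<^sub>0 where C\<^sub>0: "reachable M (subst \<tau> w) C\<^sub>0" "simulates \<tau> \<sigma> w C\<^sub>0 C"
      using reachable_simulated[OF block_length_input_at[OF nonempty bounded K w] C] by blast
    have "real (work_pos C + 1) \<le> c * log 2 (real (max 2 (length (subst \<tau> w))))"
      using c[OF subst_in_lists[OF \<tau> w] C\<^sub>0(1)] C\<^sub>0(2) by (auto simp: simulates_def)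
    (* A nonnegative factor is needed to apply the comparison of the two logarithms. *)
    also have "\<dots> \<le> \<bar>c\<bar> * log 2 (real (max 2 (length (subst \<tau> w))))"
      by (intro mult_right_mono) auto
    also have "\<dots> \<le> \<bar>c\<bar> * ((log 2 (real K) + 1) * log 2 (real (max 2 (length w))))"
      by (intro mult_left_mono log_length_subst_le[OF bounded K w]) auto
    finally show ?thesis by (simp add: mult.assoc)
  qed
  then show ?thesis
    unfolding logspace_bounded_def by blast
qed

section \<open>Logspace computable functions\<close>

text \<open>
  Nonempty blocks ensure that a head move is simulated by a single move. An empty block would have to
  be crossed in additional steps.
\<close>

theorem logspace_computable_substitution:
  assumes f: "logspace_computable X Z f" and "finite Y" and "finite Z"
    and \<tau>: "\<And>y. y \<in> Y \<Longrightarrow> \<tau> y \<in> lists X"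
    and nonempty: "\<And>y. y \<in> Y \<Longrightarrow> \<tau> y \<noteq> []"
    and \<sigma>: "\<And>z. z \<in> Z \<Longrightarrow> \<sigma> z \<in> lists V"
  shows "logspace_computable Y V (\<lambda>w. subst \<sigma> (f (subst \<tau> w)))"
proof -
  obtain M :: "(nat, nat, 'a, 'b) transducer" where M: "transducer X Z M" "logspace_bounded X M"
      "\<And>w. w \<in> lists X \<Longrightarrow> outputs M w (f w)"
    and f_lists: "f \<in> lists X \<rightarrow> lists Z"
    using f unfolding logspace_computable_def by blast
  obtain K where K: "K \<ge> 1" and bounded: "\<And>y. y \<in> Y \<Longrightarrow> length (\<tau> y) \<le> K"
    using bounded_block_length[OF \<open>finite Y\<close>, of \<tau>] by blast
  have "transducer Y V (subst_transducer \<tau> \<sigma> K M)"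
    by (rule transducer_subst_transducer[OF M(1) \<open>finite Z\<close> \<tau> nonempty bounded K \<sigma>])
  moreover have "logspace_bounded Y (subst_transducer \<tau> \<sigma> K M)"
    by (rule logspace_bounded_subst_transducer[OF M(2) \<tau> nonempty bounded K])
  moreover have "outputs (subst_transducer \<tau> \<sigma> K M) w (subst \<sigma> (f (subst \<tau> w)))"
    if w: "w \<in> lists Y" for w
    by (intro outputs_subst_transducer block_length_input_at[OF nonempty bounded K w]
        M(3) subst_in_lists[OF \<tau> w])
  moreover have "subst \<sigma> (f (subst \<tau> w)) \<in> lists V" if w: "w \<in> lists Y" for w
    by (rule subst_in_lists[OF \<sigma> Pi_mem[OF f_lists subst_in_lists[OF \<tau> w]]])
  ultimately show ?thesis
    unfolding logspace_computable_def by blast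
qed

lemma logspace_computable_Nil: "logspace_computable X Y (\<lambda>_. [])"
proof -
  define M :: "(nat, nat, 'a, 'b) transducer" where
    "M = \<lparr>states = {0}, work_alphabet = {0}, start = 0, blank = 0, delta = (\<lambda>_ _ _. None)\<rparr>"
  have halt: "step M w c = None" for w c
    by (simp add: step_def M_def)
  have reach: "reachable M w c \<longleftrightarrow> c = init_config M" for w c
    unfolding reachable_def halt by (auto elim: rtranclp.cases)
  have "transducer X Y M"
    by (simp add: transducer_def M_def)
  moreover have "logspace_bounded X M"
    unfolding logspace_bounded_def
    by (intro exI[of _ 1]) (auto simp: reach init_config_def le_log_iff)
  moreover have "outputs M w []" for w
    unfolding outputs_def reach halt by (simp add: init_config_def)
  ultimately show ?thesis
    unfolding logspace_computable_def by auto
qed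

section \<open>Words in groups\<close>

context group
begin

lemma word_value_closed:
  assumes "w \<in> lists (carrier G)"
  shows "word_value G w \<in> carrier G"
  using assms by (induction w) (auto simp: word_value_def)

lemma word_value_append:
  assumes "v \<in> lists (carrier G)" and "w \<in> lists (carrier G)"
  shows "word_value G (v @ w) = word_value G v \<otimes> word_value G w"
  using assms(1)
proof (induction v)
  case Nil
  then show ?case using word_value_closed[OF assms(2)] by (simp add: word_value_def)
next
  case (Cons x v)
  then show ?case
    using word_value_closed[OF assms(2)] word_value_closed[of v]
    by (simp add: word_value_def m_assoc)
qed

lemma word_value_subst:
  assumes "X \<subseteq> carrier G" and "Y \<subseteq> carrier G"
    and \<sigma>: "\<And>x. x \<in> X \<Longrightarrow> \<sigma> x \<in> lists Y \<and> word_value G (\<sigma> x) = x"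
    and "w \<in> lists X"
  shows "word_value G (subst \<sigma> w) = word_value G w"
  using assms(4)
proof (induction w)
  case (Cons x w)
  have "\<sigma> x \<in> lists (carrier G)" and "subst \<sigma> w \<in> lists (carrier G)"
    using \<sigma> Cons.hyps subst_in_lists[of X \<sigma> Y w] lists_mono[OF assms(2)] by blast+
  then show ?case
    using Cons \<sigma> by (simp add: word_value_append) (simp add: word_value_def)
qed simp

lemma symmetric_generating_set_word:
  assumes X: "symmetric_generating_set G X" and g: "g \<in> carrier G"
  obtains w where "w \<in> lists X" and "word_value G w = g"
proof -
  have XG: "X \<subseteq> carrier G" and inv_in: "\<And>x. x \<in> X \<Longrightarrow> inv x \<in> X"
    using X by (auto simp: symmetric_generating_set_def)
  have "g \<in> generate G X"
    using X g by (simp add: symmetric_generating_set_def)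
  then have "\<exists>w \<in> lists X. word_value G w = g"
  proof (induction rule: generate.induct)
    case one
    show ?case by (intro bexI[of _ "[]"]) (auto simp: word_value_def)
  next
    case (incl h)
    then show ?case using XG by (intro bexI[of _ "[h]"]) (auto simp: word_value_def)
  next
    case (inv h)
    then show ?case
      using XG inv_in
      by (intro bexI[of _ "[inv h]"]) (auto simp: word_value_def)
  next
    case (eng h k)
    then obtain v w where "v \<in> lists X" "word_value G v = h" "w \<in> lists X" "word_value G w = k"
      by blast
    moreover from this have "word_value G (v @ w) = word_value G v \<otimes> word_value G w"
      using XG by (intro word_value_append) auto
    ultimately show ?case
      by (intro bexI[of _ "v @ w"]) auto
  qed
  then show ?thesis using that by blast
qed

lemma symmetric_generating_set_nonempty_word:
  assumes X: "symmetric_generating_set G X" and "X \<noteq> {}" and g: "g \<in> carrier G"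
  obtains w where "w \<in> lists X" and "w \<noteq> []" and "word_value G w = g"
proof -
  obtain w where w: "w \<in> lists X" "word_value G w = g"
    using symmetric_generating_set_word[OF X g] .
  show ?thesis
  proof (cases "w = []")
    case True
    obtain x where x: "x \<in> X" using \<open>X \<noteq> {}\<close> by blast
    then have "x \<in> carrier G" and "inv x \<in> X"
      using X by (auto simp: symmetric_generating_set_def)
    moreover have "g = \<one>"
      using w True by (simp add: word_value_def)
    ultimately show ?thesis
      using x that[of "[x, inv x]"] by (simp add: word_value_def)
  next
    case False
    then show ?thesis using w that by blast
  qed
qed

lemma normal_form_subst:
  assumes L: "normal_form G X L" and "X \<subseteq> carrier G" and "Y \<subseteq> carrier G"
    and \<sigma>: "\<And>x. x \<in> X \<Longrightarrow> \<sigma> x \<in> lists Y \<and> word_value G (\<sigma> x) = x"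
  shows "normal_form G Y (subst \<sigma> ` L)"
proof -
  have LX: "L \<subseteq> lists X" and bij: "bij_betw (word_value G) L (carrier G)"
    using L by (auto simp: normal_form_def)
  have val: "word_value G (subst \<sigma> w) = word_value G w" if "w \<in> L" for w
    using word_value_subst[OF assms(2,3) \<sigma>] LX that by blast
  have "bij_betw (word_value G \<circ> subst \<sigma>) L (carrier G)"
    using bij val by (simp cong: bij_betw_cong)
  then have "bij_betw (word_value G) (subst \<sigma> ` L) (carrier G)"
    by (auto simp: bij_betw_def image_comp intro: inj_on_imageI)
  moreover have "subst \<sigma> ` L \<subseteq> lists Y"
    using LX \<sigma> subst_in_lists[of X \<sigma> Y] by blast
  ultimately show ?thesis
    by (simp add: normal_form_def)
qed

lemma trivial_has_logspace_normal_form: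
  assumes "carrier G = {\<one>}" and "Y \<subseteq> carrier G"
  shows "has_logspace_normal_form G Y"
proof -
  have "word_value G w = \<one>" if "w \<in> lists Y" for w
    using word_value_closed[of w] that lists_mono[OF assms(2)] assms(1) by auto
  moreover have "normal_form G Y {[]}"
    using assms(1) by (simp add: normal_form_def bij_betw_def word_value_def)
  ultimately show ?thesis
    unfolding has_logspace_normal_form_def logspace_normal_form_function_def
    using logspace_computable_Nil[of Y Y]
    by (intro exI[of _ "\<lambda>_. []"] exI[of _ "{[]}"] conjI) (auto simp: word_value_def)
qed

end

theorem proposition10:
  fixes G :: "('a, 'b) monoid_scheme" and X Y :: "'a set"
  assumes "group G"
    and "finite X" and "symmetric_generating_set G X"
    and "finite Y" and "symmetric_generating_set G Y"
    and "has_logspace_normal_form G X"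
  shows "has_logspace_normal_form G Y"
proof -
  interpret group G by fact
  have XG: "X \<subseteq> carrier G" and YG: "Y \<subseteq> carrier G"
    using assms(3,5) by (auto simp: symmetric_generating_set_def)
  show ?thesis
  proof (cases "X = {}")
    case True
    then have "carrier G = {\<one>\<^bsub>G\<^esub>}"
      using assms(3) generate_empty by (simp add: symmetric_generating_set_def)
    then show ?thesis
      using YG by (rule trivial_has_logspace_normal_form)
  next
    case False
    obtain f L where f: "logspace_computable X X f" and L: "normal_form G X L"
      and fL: "\<And>w. w \<in> lists X \<Longrightarrow> f w \<in> L \<and> word_value G (f w) = word_value G w"
      using assms(6)
      unfolding has_logspace_normal_form_def logspace_normal_form_function_def by blast
    have "\<forall>y\<in>Y. \<exists>w. w \<in> lists X \<and> w \<noteq> [] \<and> word_value G w = y"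
      using symmetric_generating_set_nonempty_word[OF assms(3) False] YG by (metis subsetD)
    then obtain \<tau> where \<tau>: "\<And>y. y \<in> Y \<Longrightarrow> \<tau> y \<in> lists X \<and> \<tau> y \<noteq> [] \<and> word_value G (\<tau> y) = y"
      by metis
    have "\<forall>x\<in>X. \<exists>w. w \<in> lists Y \<and> word_value G w = x"
      using symmetric_generating_set_word[OF assms(5)] XG by (metis subsetD)
    then obtain \<sigma> where \<sigma>: "\<And>x. x \<in> X \<Longrightarrow> \<sigma> x \<in> lists Y \<and> word_value G (\<sigma> x) = x"
      by metis
    let ?g = "\<lambda>w. subst \<sigma> (f (subst \<tau> w))"
    have "logspace_computable Y Y ?g"
      using f assms(2,4) \<tau> \<sigma> by (intro logspace_computable_substitution) auto
    moreover have "normal_form G Y (subst \<sigma> ` L)"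
      using normal_form_subst[OF L XG YG \<sigma>] .
    moreover have "?g w \<in> subst \<sigma> ` L \<and> word_value G (?g w) = word_value G w"
      if w: "w \<in> lists Y" for w
    proof -
      have \<tau>w: "subst \<tau> w \<in> lists X"
        using \<tau> w by (intro subst_in_lists[of Y \<tau> X]) auto
      have in_L: "f (subst \<tau> w) \<in> L"
        using fL[OF \<tau>w] by blast
      then have f_in: "f (subst \<tau> w) \<in> lists X"
        using L by (auto simp: normal_form_def)
      have "word_value G (?g w) = word_value G (f (subst \<tau> w))"
        using \<sigma> by (intro word_value_subst[OF XG YG _ f_in]) auto
      also have "\<dots> = word_value G (subst \<tau> w)"
        using fL[OF \<tau>w] by blast
      also have "\<dots> = word_value G w"
        using \<tau> by (intro word_value_subst[OF YG XG _ w]) auto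
      finally show ?thesis using in_L by blast
    qed
    ultimately show ?thesis
      unfolding has_logspace_normal_form_def logspace_normal_form_function_def by blast
  qed
qed

end
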